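(* Suppose there is no noise in the classical channel ($v=0$). When the mean squared error $\epsilon(\boldsymbol{\hat\phi})$ is minimized over $\mathbf{H}$ (for given $\mathbf{g}\neq\mathbf{0}$), $\mathbf{H}$ is forced to have unit rank, the minimizer being $$\mathbf{H}_\star(\mathbf{g})=\frac{\phi^2}{\mathbf{g}^T\mathbf{g}}\,\mathbf{g}\,\mathbf{1}^T\mathbf{R}^{-1}.$$ When $\epsilon(\boldsymbol{\hat\phi})$ is minimized over $\mathbf{g}$, $\mathbf{H}$ is allowed to have full rank, namely $\mathbf{H}=\mathbb{I}$. In both scenarios the error satisfies $$\min_{\mathbf{H}\ \mathrm{or}\ \mathbf{g}}\epsilon(\boldsymbol{\hat\phi})=\Omega\left(\frac{1}{KN_e^2r}\right).$$ Consequently, the asymptotic optimal performance is not uniquely determined by the rank of $\mathbf{H}$.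
   Context: Let $K,N_e,r\ge 1$ be integers. There are $K$ clusters, each of $N_e$ entangled quantum states and each measured $r$ times. The vector $\boldsymbol{\hat\phi}=(\hat\phi_1,\dots,\hat\phi_K)^T$ collects the resulting independent, identically distributed, unbiased estimates of a real parameter $\phi$, each of variance $\frac{1}{N_e^2r}$, and $\mathbf{R}=\mathbb{E}[\boldsymbol{\hat\phi}\boldsymbol{\hat\phi}^T]$ is its autocorrelation matrix. The final estimate is $f(\boldsymbol{\hat\phi})=\mathbf{g}^T(\mathbf{H}\boldsymbol{\hat\phi}+\mathbf{n})$, where $\mathbf{H}$ is a real $K\times K$ channel matrix, $\mathbf{g}\in\mathbb{R}^K$ is a combining vector, and $\mathbf{n}$ has independent zero-mean Gaussian entries of variance $v$ (so the noise is absent when $v=0$). The mean squared error is $\epsilon(\boldsymbol{\hat\phi})=\mathbb{E}\big[(f(\boldsymbol{\hat\phi})-\phi)^2\big]=\mathbf{g}^T(\mathbf{H}\mathbf{R}\mathbf{H}^T+v\mathbb{I})\mathbf{g}+\phi^2-2\phi^2\mathbf{1}^T\mathbf{H}^T\mathbf{g}$. Here $\mathbf{1}\in\mathbb{R}^K$ is the all-ones vector and $\mathbb{I}$ is the identity matrix. The notation $f(x)=\Omega(g(x))$ means that there exist $x',k\in\mathbb{R}$ such that $f(x)\ge|k|\,g(x)$ for all $x\ge x'$; here the growing variable is the number of clusters $K$.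
   Formalization: Minimizers over H are not unique for K≥2 and can have higher rank, so H⋆ is shown to be a minimizer of rank one, unique after projection onto g and of least Frobenius norm; the rank-one and Ω claims assume φ≠0, since for φ=0 H⋆ and the minimal error vanish. *)

theory Defs
  imports
    "HOL-Probability.Probability"
    "HOL-Library.Landau_Symbols"
    "Jordan_Normal_Form.Gauss_Jordan_Elimination"
    "Jordan_Normal_Form.DL_Rank"
begin

text \<open>
  \<open>X i\<close> is the estimate produced by cluster \<open>i\<close> (clusters are indexed by \<open>0, \<dots>, K - 1\<close>), and
  \<open>n i\<close> is the noise in the \<open>i\<close>-th channel output. Gaussian noise of variance \<open>0\<close> is read as the
  point mass at \<open>0\<close>, which \<open>normal_density 0 0\<close> does not describe. Estimates and noise are
  jointly independent; this adds no restriction when \<open>v = 0\<close>.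
\<close>

locale cluster_model = prob_space M for M :: "'a measure" +
  fixes K N\<^sub>e r :: nat
    and \<phi> v :: real
    and X n :: "nat \<Rightarrow> 'a \<Rightarrow> real"
  assumes K_pos: "K \<ge> 1" and N\<^sub>e_pos: "N\<^sub>e \<ge> 1" and r_pos: "r \<ge> 1"
    and v_nonneg: "v \<ge> 0"
    and independent: "indep_vars (\<lambda>_. borel) (case_sum X n) ({..<K} <+> {..<K})"
    and identically_distributed:
      "\<And>i j. i < K \<Longrightarrow> j < K \<Longrightarrow> distr M borel (X i) = distr M borel (X j)"
    and square_integrable: "\<And>i. i < K \<Longrightarrow> integrable M (\<lambda>\<omega>. (X i \<omega>)\<^sup>2)"
    and unbiased: "\<And>i. i < K \<Longrightarrow> expectation (X i) = \<phi>"
    and variance_estimate: "\<And>i. i < K \<Longrightarrow> variance (X i) = 1 / ((real N\<^sub>e)\<^sup>2 * real r)"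
    and noise: "\<And>i. i < K \<Longrightarrow>
      (if v = 0 then (AE \<omega> in M. n i \<omega> = 0)
       else distributed M lborel (n i) (normal_density 0 (sqrt v)))"

definition autocorrelation :: "'a measure \<Rightarrow> nat \<Rightarrow> (nat \<Rightarrow> 'a \<Rightarrow> real) \<Rightarrow> real mat" where
  "autocorrelation M K X = mat K K (\<lambda>(i, j). \<integral>\<omega>. X i \<omega> * X j \<omega> \<partial>M)"

definition final_estimate ::
  "nat \<Rightarrow> (nat \<Rightarrow> 'a \<Rightarrow> real) \<Rightarrow> (nat \<Rightarrow> 'a \<Rightarrow> real) \<Rightarrow> real mat \<Rightarrow> real vec \<Rightarrow> 'a \<Rightarrow> real" where
  "final_estimate K X n H g \<omega> =
     scalar_prod g (H *\<^sub>v vec K (\<lambda>i. X i \<omega>) + vec K (\<lambda>i. n i \<omega>))"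

definition mse ::
  "'a measure \<Rightarrow> nat \<Rightarrow> (nat \<Rightarrow> 'a \<Rightarrow> real) \<Rightarrow> (nat \<Rightarrow> 'a \<Rightarrow> real) \<Rightarrow> real \<Rightarrow>
   real mat \<Rightarrow> real vec \<Rightarrow> real" where
  "mse M K X n \<phi> H g = (\<integral>\<omega>. (final_estimate K X n H g \<omega> - \<phi>)\<^sup>2 \<partial>M)"

definition min_mse_over_H ::
  "'a measure \<Rightarrow> nat \<Rightarrow> (nat \<Rightarrow> 'a \<Rightarrow> real) \<Rightarrow> (nat \<Rightarrow> 'a \<Rightarrow> real) \<Rightarrow> real \<Rightarrow> real vec \<Rightarrow> real" where
  "min_mse_over_H M K X n \<phi> g = (INF H \<in> carrier_mat K K. mse M K X n \<phi> H g)"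

definition min_mse_over_g ::
  "'a measure \<Rightarrow> nat \<Rightarrow> (nat \<Rightarrow> 'a \<Rightarrow> real) \<Rightarrow> (nat \<Rightarrow> 'a \<Rightarrow> real) \<Rightarrow> real \<Rightarrow> real mat \<Rightarrow> real" where
  "min_mse_over_g M K X n \<phi> H = (INF g \<in> carrier_vec K. mse M K X n \<phi> H g)"

definition is_minimizer_H ::
  "'a measure \<Rightarrow> nat \<Rightarrow> (nat \<Rightarrow> 'a \<Rightarrow> real) \<Rightarrow> (nat \<Rightarrow> 'a \<Rightarrow> real) \<Rightarrow> real \<Rightarrow>
   real vec \<Rightarrow> real mat \<Rightarrow> bool" where
  "is_minimizer_H M K X n \<phi> g H \<longleftrightarrow>
     is_arg_min (\<lambda>H'. mse M K X n \<phi> H' g) (\<lambda>H'. H' \<in> carrier_mat K K) H"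

definition is_minimizer_g ::
  "'a measure \<Rightarrow> nat \<Rightarrow> (nat \<Rightarrow> 'a \<Rightarrow> real) \<Rightarrow> (nat \<Rightarrow> 'a \<Rightarrow> real) \<Rightarrow> real \<Rightarrow>
   real mat \<Rightarrow> real vec \<Rightarrow> bool" where
  "is_minimizer_g M K X n \<phi> H g \<longleftrightarrow>
     is_arg_min (\<lambda>g'. mse M K X n \<phi> H g') (\<lambda>g'. g' \<in> carrier_vec K) g"

definition outer_prod :: "real vec \<Rightarrow> real vec \<Rightarrow> real mat" where
  "outer_prod u w = mat (dim_vec u) (dim_vec w) (\<lambda>(i, j). u $ i * w $ j)"

definition ones_vec :: "nat \<Rightarrow> real vec" where
  "ones_vec K = vec K (\<lambda>_. 1)"

text \<open>
  \<open>mat_inverse\<close> returns \<open>None\<close> only for non-invertible matrices; the autocorrelation matrix of a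
  \<open>cluster_model\<close> is invertible because the variance of the estimates is positive.
\<close>

definition H_star ::
  "'a measure \<Rightarrow> nat \<Rightarrow> (nat \<Rightarrow> 'a \<Rightarrow> real) \<Rightarrow> real \<Rightarrow> real vec \<Rightarrow> real mat" where
  "H_star M K X \<phi> g =
     (\<phi>\<^sup>2 / scalar_prod g g) \<cdot>\<^sub>m
       (outer_prod g (ones_vec K) * the (mat_inverse (autocorrelation M K X)))"

definition frobenius_norm :: "real mat \<Rightarrow> real" where
  "frobenius_norm A = sqrt (\<Sum>i<dim_row A. \<Sum>j<dim_col A. (A $$ (i, j))\<^sup>2)"

end

theory Submission
  imports Defs
begin

text \<open>
  Without noise the final estimate is \<open>\<Sum>j. a j * X j\<close> with \<open>a = H\<^sup>T g\<close>. Since the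
  autocorrelation matrix is \<open>\<sigma>2 I + \<phi>\<^sup>2 1 1\<^sup>T\<close>, with \<open>\<sigma>2\<close> the variance of one
  estimate, the mean squared error is
  \<open>\<sigma>2 |a|\<^sup>2 + \<phi>\<^sup>2 (1\<^sup>T a - 1)\<^sup>2\<close>. Completing the square gives the unique optimum
  \<open>a = c 1\<close> with \<open>c = \<phi>\<^sup>2 / (\<sigma>2 + K \<phi>\<^sup>2)\<close> and minimal error \<open>\<sigma>2 c\<close>. Minimizers over \<open>H\<close>
  are thus the solutions of the linear system \<open>H\<^sup>T g = c 1\<close>, whose solution of least Frobenius
  norm is the rank-one matrix \<open>c g 1\<^sup>T / g\<^sup>T g\<close>; for \<open>H = I\<close> the same optimum is reached at
  \<open>g = c 1\<close>. For a general \<open>H\<close> minimization over \<open>g\<close> is a linear least squares problem.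
\<close>

unbundle no vec_syntax

section \<open>Linear least squares\<close>

text \<open>Columns are added one at a time. The induction hypothesis is used for \<open>b\<close>
  and also with the new column as right-hand side, hence \<open>b\<close> stays arbitrary. Linearly
  dependent columns are covered.\<close>

lemma normal_equations_solvable:
  fixes A :: "'t \<Rightarrow> nat \<Rightarrow> real"
  assumes "finite T"
  shows "\<exists>x. \<forall>k<m. (\<Sum>t\<in>T. A t k * (b t - (\<Sum>i<m. A t i * x i))) = 0"
proof (induction m arbitrary: b)
  case 0
  show ?case by simp
next
  case (Suc m)
  obtain h where h: "\<forall>k<m. (\<Sum>t\<in>T. A t k * (A t m - (\<Sum>i<m. A t i * h i))) = 0"
    using Suc.IH[of "\<lambda>t. A t m"] by (rule exE)
  obtain x where x: "\<forall>k<m. (\<Sum>t\<in>T. A t k * (b t - (\<Sum>i<m. A t i * x i))) = 0"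
    using Suc.IH[of b] by (rule exE)
  \<comment> \<open>Gram--Schmidt step: \<open>e\<close> is the part of column \<open>m\<close> orthogonal to the earlier columns.\<close>
  define e where "e t = A t m - (\<Sum>i<m. A t i * h i)" for t
  define \<rho> where "\<rho> t = b t - (\<Sum>i<m. A t i * x i)" for t
  have h': "(\<Sum>t\<in>T. A t k * e t) = 0" if "k < m" for k
    using h that by (simp add: e_def)
  have x': "(\<Sum>t\<in>T. A t k * \<rho> t) = 0" if "k < m" for k
    using x that by (simp add: \<rho>_def)
  \<comment> \<open>The coefficient of the projection of the old residual \<open>\<rho>\<close> onto
    \<open>e\<close>. If \<open>e\<close> vanishes on \<open>T\<close>, the quotient is 0 and
    nothing is corrected.\<close>
  define l where "l = (\<Sum>t\<in>T. e t * \<rho> t) / (\<Sum>t\<in>T. (e t)\<^sup>2)"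
  \<comment> \<open>Since \<open>e\<close> is column \<open>m\<close> minus its fit by
    \<open>h\<close>, adding \<open>l * e\<close> to the fit lowers the earlier coefficients by
    \<open>l * h\<close>.\<close>
  define y where "y i = (if i < m then x i - l * h i else l)" for i
  have residual: "b t - (\<Sum>i<Suc m. A t i * y i) = \<rho> t - l * e t" for t
    by (simp add: y_def \<rho>_def e_def algebra_simps sum_subtractf sum_distrib_left)
  have orth_e: "(\<Sum>t\<in>T. e t * (\<rho> t - l * e t)) = 0"
  proof (cases "(\<Sum>t\<in>T. (e t)\<^sup>2) = 0")
    case True
    then have "\<forall>t\<in>T. e t = 0"
      using \<open>finite T\<close> by (simp add: sum_nonneg_eq_0_iff)
    then show ?thesis by simp
  next
    case False
    have "(\<Sum>t\<in>T. e t * (\<rho> t - l * e t)) = (\<Sum>t\<in>T. e t * \<rho> t) - l * (\<Sum>t\<in>T. (e t)\<^sup>2)"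
      by (simp add: algebra_simps sum_subtractf sum_distrib_left power2_eq_square)
    then show ?thesis using False by (simp add: l_def)
  qed
  have orth: "(\<Sum>t\<in>T. A t k * (\<rho> t - l * e t)) = 0" if "k < m" for k
  proof -
    have "(\<Sum>t\<in>T. A t k * (\<rho> t - l * e t)) = (\<Sum>t\<in>T. A t k * \<rho> t) - l * (\<Sum>t\<in>T. A t k * e t)"
      by (simp add: algebra_simps sum_subtractf sum_distrib_left)
    then show ?thesis using h' x' that by simp
  qed
  \<comment> \<open>Column \<open>m\<close> is \<open>e\<close> plus a combination of the earlier
    columns, and the new residual is orthogonal to all of these.\<close>
  have orth_m: "(\<Sum>t\<in>T. A t m * (\<rho> t - l * e t)) = 0"
  proof -
    have "(\<Sum>t\<in>T. A t m * (\<rho> t - l * e t))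
        = (\<Sum>t\<in>T. e t * (\<rho> t - l * e t) + (\<Sum>i<m. h i * (A t i * (\<rho> t - l * e t))))"
      by (rule sum.cong) (simp_all add: e_def algebra_simps sum_distrib_left sum_distrib_right
          sum_subtractf sum.distrib)
    also have "\<dots> = (\<Sum>t\<in>T. e t * (\<rho> t - l * e t))
        + (\<Sum>i<m. h i * (\<Sum>t\<in>T. A t i * (\<rho> t - l * e t)))"
      by (simp add: sum.distrib sum_distrib_left sum.swap[of _ T])
    finally show ?thesis using orth_e orth by simp
  qed
  have "\<forall>k<Suc m. (\<Sum>t\<in>T. A t k * (b t - (\<Sum>i<Suc m. A t i * y i))) = 0"
    unfolding residual using orth orth_m by (simp add: less_Suc_eq)
  then show ?case by blast
qed

text \<open>By the normal equations the residual of \<open>x\<close> is orthogonal to every column,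
  so by Pythagoras passing to \<open>y\<close> adds the squared length of \<open>d\<close>, the
  image of \<open>y - x\<close>.\<close>

lemma least_squares_minimizer_exists:
  fixes A :: "'t \<Rightarrow> nat \<Rightarrow> real"
  assumes "finite T"
  shows "\<exists>x. \<forall>y. (\<Sum>t\<in>T. ((\<Sum>i<m. A t i * x i) - b t)\<^sup>2) \<le> (\<Sum>t\<in>T. ((\<Sum>i<m. A t i * y i) - b t)\<^sup>2)"
proof -
  obtain x where x: "\<forall>k<m. (\<Sum>t\<in>T. A t k * (b t - (\<Sum>i<m. A t i * x i))) = 0"
    using normal_equations_solvable[OF assms, of m A b] by (rule exE)
  have "(\<Sum>t\<in>T. ((\<Sum>i<m. A t i * x i) - b t)\<^sup>2) \<le> (\<Sum>t\<in>T. ((\<Sum>i<m. A t i * y i) - b t)\<^sup>2)" for y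
  proof -
    define \<rho> where "\<rho> t = b t - (\<Sum>i<m. A t i * x i)" for t
    define d where "d t = (\<Sum>i<m. A t i * (y i - x i))" for t
    have "(\<Sum>t\<in>T. d t * \<rho> t) = (\<Sum>t\<in>T. \<Sum>i<m. (y i - x i) * (A t i * \<rho> t))"
      unfolding d_def sum_distrib_right by (intro sum.cong refl) (simp add: mult_ac)
    also have "\<dots> = (\<Sum>i<m. (y i - x i) * (\<Sum>t\<in>T. A t i * \<rho> t))"
      by (simp add: sum_distrib_left sum.swap[of _ T])
    also have "\<dots> = 0" using x by (simp add: \<rho>_def)
    finally have orth: "(\<Sum>t\<in>T. d t * \<rho> t) = 0" .
    have "((\<Sum>i<m. A t i * y i) - b t)\<^sup>2
        = ((\<Sum>i<m. A t i * x i) - b t)\<^sup>2 + (d t)\<^sup>2 - 2 * (d t * \<rho> t)" for t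
    proof -
      have "(\<Sum>i<m. A t i * y i) - b t = d t - \<rho> t"
        by (simp add: d_def \<rho>_def algebra_simps sum_subtractf)
      moreover have "(\<Sum>i<m. A t i * x i) - b t = - \<rho> t"
        by (simp add: \<rho>_def)
      ultimately show ?thesis by (simp only:) (simp add: power2_eq_square algebra_simps)
    qed
    then have "(\<Sum>t\<in>T. ((\<Sum>i<m. A t i * y i) - b t)\<^sup>2)
        = (\<Sum>t\<in>T. ((\<Sum>i<m. A t i * x i) - b t)\<^sup>2) + (\<Sum>t\<in>T. (d t)\<^sup>2)"
      using orth by (simp add: sum.distrib sum_subtractf flip: sum_distrib_left)
    moreover have "(\<Sum>t\<in>T. (d t)\<^sup>2) \<ge> 0" by (simp add: sum_nonneg)
    ultimately show ?thesis by simp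
  qed
  then show ?thesis by blast
qed

section \<open>The risk of a weight vector and its minimum\<close>

text \<open>Variance plus squared bias of a weighted sum of the estimates: \<open>s\<close> stands
  for the variance of one estimate and \<open>p\<close> for the squared parameter.\<close>

definition risk :: "nat \<Rightarrow> real \<Rightarrow> real \<Rightarrow> (nat \<Rightarrow> real) \<Rightarrow> real" where
  "risk K s p a = s * (\<Sum>j<K. (a j)\<^sup>2) + p * ((\<Sum>j<K. a j) - 1)\<^sup>2"

lemma risk_complete_square:
  fixes K :: nat and s p :: real
  assumes "s > 0" "p \<ge> 0"
  defines "c \<equiv> p / (s + real K * p)"
  shows "risk K s p a =
    s * p / (s + real K * p) + s * (\<Sum>j<K. (a j - c)\<^sup>2) + p * (\<Sum>j<K. a j - c)\<^sup>2"
proof -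
  define D where "D = s + real K * p"
  have D: "D > 0" using assms by (auto simp: D_def intro: add_pos_nonneg)
  \<comment> \<open>The stationarity condition of the risk at constant weights \<open>c\<close>.
    Trading \<open>s * c\<close> for a multiple of \<open>p\<close> makes the cross terms
    cancel.\<close>
  have sc: "s * c = p * (1 - real K * c)"
    using D by (simp add: c_def flip: D_def) (simp add: field_simps D_def)
  have q: "s * p / (s + real K * p) = s * c" by (simp add: c_def)
  define S where "S = (\<Sum>j<K. a j)"
  define Q where "Q = (\<Sum>j<K. (a j)\<^sup>2)"
  have 1: "(\<Sum>j<K. (a j - c)\<^sup>2) = Q - 2 * c * S + real K * c\<^sup>2"
    by (simp add: power2_diff sum.distrib sum_subtractf S_def Q_def sum_distrib_left mult.commute
        mult.left_commute)
  have 2: "(\<Sum>j<K. a j - c) = S - real K * c"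
    by (simp add: S_def sum_subtractf)
  have 3: "s * c * S = p * (1 - real K * c) * S" "s * c * c = p * (1 - real K * c) * c"
    by (simp_all add: sc)
  have "s * c + s * (Q - 2 * c * S + real K * c\<^sup>2) + p * (S - real K * c)\<^sup>2
      = s * c + s * Q - 2 * (s * c * S) + real K * (s * c * c) + p * (S - real K * c)\<^sup>2"
    by (simp add: algebra_simps power2_eq_square)
  also have "\<dots> = s * Q + p * (S - 1)\<^sup>2"
    unfolding 3 sc by (simp add: algebra_simps power2_eq_square)
  finally show ?thesis
    unfolding q 1 2 by (simp add: risk_def S_def Q_def)
qed

lemma risk_ge:
  fixes K :: nat and s p :: real
  assumes "s > 0" "p \<ge> 0"
  shows "risk K s p a \<ge> s * p / (s + real K * p)"
  unfolding risk_complete_square[OF assms] using assms by (simp add: sum_nonneg)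

text \<open>Both remaining squares are nonnegative, and the first, with positive factor
  \<open>s\<close>, already forces every weight.\<close>

lemma risk_eq_min_iff:
  fixes K :: nat and s p :: real
  assumes "s > 0" "p \<ge> 0"
  shows "risk K s p a = s * p / (s + real K * p) \<longleftrightarrow> (\<forall>j<K. a j = p / (s + real K * p))"
    (is "_ = ?m \<longleftrightarrow> (\<forall>j<K. a j = ?c)")
proof
  assume "risk K s p a = ?m"
  then have "s * (\<Sum>j<K. (a j - ?c)\<^sup>2) + p * (\<Sum>j<K. a j - ?c)\<^sup>2 = 0"
    unfolding risk_complete_square[OF assms] by simp
  moreover have "s * (\<Sum>j<K. (a j - ?c)\<^sup>2) \<ge> 0" "p * (\<Sum>j<K. a j - ?c)\<^sup>2 \<ge> 0"
    using assms by (simp_all add: sum_nonneg)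
  ultimately have "(\<Sum>j<K. (a j - ?c)\<^sup>2) = 0"
    using assms by (smt (verit) mult_eq_0_iff)
  then show "\<forall>j<K. a j = ?c"
    by (simp add: sum_nonneg_eq_0_iff)
next
  assume "\<forall>j<K. a j = ?c"
  then show "risk K s p a = ?m"
    unfolding risk_complete_square[OF assms] by simp
qed

text \<open>Provides a minimizing \<open>g\<close> for every channel matrix, singular ones included;
  there \<open>B\<close> is the transpose of \<open>H\<close>.\<close>

lemma risk_linear_minimizer_exists:
  fixes K m :: nat and s p :: real and B :: "nat \<Rightarrow> nat \<Rightarrow> real"
  assumes "s \<ge> 0" "p \<ge> 0"
  shows "\<exists>x. \<forall>y. risk K s p (\<lambda>j. \<Sum>i<m. B j i * x i) \<le> risk K s p (\<lambda>j. \<Sum>i<m. B j i * y i)"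
proof -
  \<comment> \<open>The risk as a sum of \<open>K + 1\<close> squared residuals; row \<open>K\<close> is the bias term.\<close>
  define A where "A t i = (if t < K then sqrt s * B t i else sqrt p * (\<Sum>j<K. B j i))" for t i
  define b where "b t = (if t < K then 0 else sqrt p)" for t
  have "risk K s p (\<lambda>j. \<Sum>i<m. B j i * y i) = (\<Sum>t<Suc K. ((\<Sum>i<m. A t i * y i) - b t)\<^sup>2)" for y
  proof -
    have "(\<Sum>t<K. ((\<Sum>i<m. A t i * y i) - b t)\<^sup>2) = (\<Sum>j<K. (sqrt s * (\<Sum>i<m. B j i * y i))\<^sup>2)"
      by (intro sum.cong) (simp_all add: A_def b_def sum_distrib_left mult.assoc)
    also have "\<dots> = s * (\<Sum>j<K. (\<Sum>i<m. B j i * y i)\<^sup>2)"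
      using assms by (simp add: power_mult_distrib flip: sum_distrib_left)
    finally have 1: "(\<Sum>t<K. ((\<Sum>i<m. A t i * y i) - b t)\<^sup>2) = s * (\<Sum>j<K. (\<Sum>i<m. B j i * y i)\<^sup>2)" .
    have "(\<Sum>i<m. A K i * y i) - b K = sqrt p * ((\<Sum>j<K. \<Sum>i<m. B j i * y i) - 1)"
      by (subst sum.swap)
        (simp add: A_def b_def right_diff_distrib sum_distrib_left sum_distrib_right mult.assoc)
    then have 2: "((\<Sum>i<m. A K i * y i) - b K)\<^sup>2 = p * ((\<Sum>j<K. \<Sum>i<m. B j i * y i) - 1)\<^sup>2"
      using assms by (simp add: power_mult_distrib)
    show ?thesis by (simp add: risk_def 1 2)
  qed
  then show ?thesis
    using least_squares_minimizer_exists[where T = "{..<Suc K}" and m = m and A = A and b = b] by simp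
qed

section \<open>Ranks and squared lengths\<close>

lemma (in vec_space) lin_indpt_singleton:
  assumes "u \<in> carrier_vec n" "u \<noteq> 0\<^sub>v n"
  shows "lin_indpt {u}"
  using lindep_span[of "{u}"] span_empty assms by (simp add: module_vec_simps)

text \<open>The product form bounds the rank by one from above; the nonzero entry at
  \<open>i\<^sub>0\<close>, \<open>j\<^sub>0\<close> yields an independent column and hence the
  lower bound.\<close>

lemma (in vec_space) rank_one_product_entries:
  assumes "A \<in> carrier_mat n nc"
    and "\<And>i j. i < n \<Longrightarrow> j < nc \<Longrightarrow> A $$ (i, j) = u i * w j"
    and "i\<^sub>0 < n" "j\<^sub>0 < nc" "u i\<^sub>0 \<noteq> 0" "w j\<^sub>0 \<noteq> 0"
  shows "rank A = 1"
proof -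
  have col: "col A j\<^sub>0 \<in> set (cols A)"
    using assms by (metis carrier_matD(2) cols_length cols_nth nth_mem)
  have "col A j\<^sub>0 $ i\<^sub>0 \<noteq> 0" using assms by simp
  then have "col A j\<^sub>0 \<noteq> 0\<^sub>v n" using assms(3) by (metis index_zero_vec(1))
  then have "lin_indpt {col A j\<^sub>0}"
    by (intro lin_indpt_singleton col_carrier_vec[OF assms(4,1)])
  with col have "card {col A j\<^sub>0} \<le> rank A"
    by (intro rank_ge_card_indpt[OF assms(1)]) simp_all
  moreover have "rank A \<le> 1"
    by (rule rank_le_1_product_entries[OF assms(1)]) (use assms(1,2) in auto)
  ultimately show ?thesis by simp
qed

lemma rank_identity_mat: "vec_space.rank K (1\<^sub>m K :: real mat) = K"
  using vec_space.det_rank_iff[of "1\<^sub>m K :: real mat" K] by simp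

lemma scalar_prod_self_pos:
  fixes g :: "real vec"
  assumes "g \<in> carrier_vec K" "g \<noteq> 0\<^sub>v K"
  shows "scalar_prod g g = (\<Sum>i<K. g $ i * g $ i)" "scalar_prod g g > 0"
proof -
  show eq: "scalar_prod g g = (\<Sum>i<K. g $ i * g $ i)"
    using assms by (simp add: scalar_prod_def atLeast0LessThan)
  obtain i where "i < K" "g $ i \<noteq> 0"
    using assms by (metis carrier_vecD eq_vecI index_zero_vec)
  then have "(\<Sum>i<K. g $ i * g $ i) > 0"
    by (intro sum_pos2[of _ i]) (auto simp: zero_less_mult_iff linorder_neq_iff)
  then show "scalar_prod g g > 0" by (simp add: eq)
qed

section \<open>Moments of the estimates and the noiseless mean squared error\<close>

locale noiseless_cluster_model = cluster_model +
  assumes noiseless: "v = 0"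
begin

definition \<sigma>2 :: real where "\<sigma>2 = 1 / ((real N\<^sub>e)\<^sup>2 * real r)"

text \<open>The autocorrelation matrix maps the all-ones vector to \<open>ones_eigenvalue\<close> times itself.\<close>

abbreviation ones_eigenvalue :: real where "ones_eigenvalue \<equiv> \<sigma>2 + real K * \<phi>\<^sup>2"

abbreviation optimal_weight :: real where "optimal_weight \<equiv> \<phi>\<^sup>2 / ones_eigenvalue"

lemma \<sigma>2_pos: "\<sigma>2 > 0"
  using N\<^sub>e_pos r_pos by (simp add: \<sigma>2_def)

lemma ones_eigenvalue_pos: "ones_eigenvalue > 0"
  using \<sigma>2_pos by (simp add: add_pos_nonneg)

lemma measurable_estimate: "i < K \<Longrightarrow> X i \<in> borel_measurable M"
  using independent unfolding indep_vars_def2 by force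

lemma integrable_estimate: "i < K \<Longrightarrow> integrable M (X i)"
  using square_integrable_imp_integrable[OF measurable_estimate square_integrable] .

text \<open>On the diagonal the second moment is variance plus squared mean; off the diagonal
  independence factors the expectation.\<close>

lemma
  assumes "i < K" "j < K"
  shows integrable_estimate_mult: "integrable M (\<lambda>\<omega>. X i \<omega> * X j \<omega>)"
    and expectation_estimate_mult:
      "expectation (\<lambda>\<omega>. X i \<omega> * X j \<omega>) = \<phi>\<^sup>2 + (if i = j then \<sigma>2 else 0)"
proof -
  have "integrable M (\<lambda>\<omega>. X i \<omega> * X j \<omega>)
      \<and> expectation (\<lambda>\<omega>. X i \<omega> * X j \<omega>) = \<phi>\<^sup>2 + (if i = j then \<sigma>2 else 0)"
  proof (cases "i = j")
    case True
    have "expectation (\<lambda>\<omega>. (X i \<omega>)\<^sup>2) = \<phi>\<^sup>2 + \<sigma>2"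
      using variance_eq[OF integrable_estimate[OF assms(1)] square_integrable[OF assms(1)]]
        unbiased[OF assms(1)] variance_estimate[OF assms(1)]
      by (simp add: \<sigma>2_def)
    then show ?thesis
      using square_integrable assms True by (simp add: power2_eq_square)
  next
    case False
    \<comment> \<open>Estimates sit at the \<open>Inl\<close> indices of the joint family of
      estimates and noise. As \<open>i\<close> and \<open>j\<close> differ, the product over this
      set is the product of two estimates.\<close>
    have indep: "indep_vars (\<lambda>_. borel) (case_sum X n) {Inl i, Inl j :: nat + nat}"
      using assms by (intro indep_vars_subset[OF independent]) auto
    have int: "\<And>k. k \<in> {Inl i, Inl j :: nat + nat} \<Longrightarrow> integrable M (case_sum X n k)"
      using integrable_estimate assms by auto
    have "integrable M (\<lambda>\<omega>. \<Prod>k\<in>{Inl i, Inl j}. case_sum X n k \<omega>)"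
      by (rule indep_vars_integrable[OF _ indep int]) auto
    moreover have "expectation (\<lambda>\<omega>. \<Prod>k\<in>{Inl i, Inl j}. case_sum X n k \<omega>)
        = (\<Prod>k\<in>{Inl i, Inl j}. expectation (case_sum X n k))"
      by (rule indep_vars_lebesgue_integral[OF _ indep int]) auto
    ultimately show ?thesis
      using False assms unbiased by (simp add: power2_eq_square)
  qed
  then show "integrable M (\<lambda>\<omega>. X i \<omega> * X j \<omega>)"
    "expectation (\<lambda>\<omega>. X i \<omega> * X j \<omega>) = \<phi>\<^sup>2 + (if i = j then \<sigma>2 else 0)" by auto
qed

lemma expectation_affine_error:
  "expectation (\<lambda>\<omega>. ((\<Sum>j<K. a j * X j \<omega>) - \<phi>)\<^sup>2) = risk K \<sigma>2 (\<phi>\<^sup>2) a"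
proof -
  have "expectation (\<lambda>\<omega>. ((\<Sum>j<K. a j * X j \<omega>) - \<phi>)\<^sup>2)
      = expectation (\<lambda>\<omega>. (\<Sum>i<K. \<Sum>j<K. a i * a j * (X i \<omega> * X j \<omega>))
          - 2 * \<phi> * (\<Sum>j<K. a j * X j \<omega>) + \<phi>\<^sup>2)"
    by (intro Bochner_Integration.integral_cong)
      (simp_all add: power2_diff power2_eq_square sum_product algebra_simps)
  also have "\<dots> = (\<Sum>i<K. \<Sum>j<K. a i * a j * expectation (\<lambda>\<omega>. X i \<omega> * X j \<omega>))
      - 2 * \<phi> * (\<Sum>j<K. a j * expectation (X j)) + \<phi>\<^sup>2"
  proof -
    have quad: "integrable M (\<lambda>\<omega>. \<Sum>j<K. a i * a j * (X i \<omega> * X j \<omega>))" if "i < K" for i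
      using that by (intro Bochner_Integration.integrable_sum integrable_mult_right
          integrable_estimate_mult) auto
    have quad': "integrable M (\<lambda>\<omega>. \<Sum>i<K. \<Sum>j<K. a i * a j * (X i \<omega> * X j \<omega>))"
      by (intro Bochner_Integration.integrable_sum quad) simp
    have lin: "integrable M (\<lambda>\<omega>. \<Sum>j<K. a j * X j \<omega>)"
      by (intro Bochner_Integration.integrable_sum integrable_mult_right integrable_estimate) auto
    have "expectation (\<lambda>\<omega>. \<Sum>j<K. a i * a j * (X i \<omega> * X j \<omega>))
        = (\<Sum>j<K. a i * a j * expectation (\<lambda>\<omega>. X i \<omega> * X j \<omega>))" if "i < K" for i
      using that integrable_estimate_mult by (subst Bochner_Integration.integral_sum) auto
    then have "expectation (\<lambda>\<omega>. \<Sum>i<K. \<Sum>j<K. a i * a j * (X i \<omega> * X j \<omega>))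
        = (\<Sum>i<K. \<Sum>j<K. a i * a j * expectation (\<lambda>\<omega>. X i \<omega> * X j \<omega>))"
      by (subst Bochner_Integration.integral_sum) (rule quad, simp_all)
    moreover have "expectation (\<lambda>\<omega>. \<Sum>j<K. a j * X j \<omega>) = (\<Sum>j<K. a j * expectation (X j))"
      using integrable_estimate by (subst Bochner_Integration.integral_sum) auto
    ultimately show ?thesis
      using quad' lin by (simp add: prob_space )
  qed
  \<comment> \<open>The common part \<open>\<phi>\<^sup>2\<close> of all moments gives the squared
    sum of the weights; the diagonal surplus \<open>\<sigma>2\<close> gives their sum of
    squares.\<close>
  also have "(\<Sum>i<K. \<Sum>j<K. a i * a j * expectation (\<lambda>\<omega>. X i \<omega> * X j \<omega>))
      = (\<Sum>i<K. \<Sum>j<K. \<phi>\<^sup>2 * (a i * a j) + (if j = i then \<sigma>2 * (a i)\<^sup>2 else 0))"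
    by (intro sum.cong) (auto simp: expectation_estimate_mult algebra_simps power2_eq_square)
  also have "\<dots> = \<phi>\<^sup>2 * (\<Sum>j<K. a j)\<^sup>2 + \<sigma>2 * (\<Sum>j<K. (a j)\<^sup>2)"
    unfolding power2_eq_square[of "sum a _"] sum_product by (simp add: sum.distrib sum_distrib_left)
  also have "(\<Sum>j<K. a j * expectation (X j)) = \<phi> * (\<Sum>j<K. a j)"
    using unbiased by (simp add: sum_distrib_left mult.commute)
  finally show ?thesis
    by (simp add: risk_def algebra_simps power2_eq_square)
qed

text \<open>The noise vanishes only almost everywhere, so the integrands agree only there and
  measurability is needed to equate the integrals. Exchanging the sums shows that \<open>H\<close>
  and \<open>g\<close> enter only through the weights H^T g.\<close>

lemma mse_eq_risk:
  assumes "H \<in> carrier_mat K K" "g \<in> carrier_vec K"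
  shows "mse M K X n \<phi> H g = risk K \<sigma>2 (\<phi>\<^sup>2) (\<lambda>j. \<Sum>i<K. H $$ (i, j) * g $ i)"
proof -
  have "AE \<omega> in M. \<forall>i<K. n i \<omega> = 0"
    using noise noiseless by (simp add: AE_all_countable)
  then have "AE \<omega> in M. (final_estimate K X n H g \<omega> - \<phi>)\<^sup>2
      = ((\<Sum>j<K. (\<Sum>i<K. H $$ (i, j) * g $ i) * X j \<omega>) - \<phi>)\<^sup>2"
  proof (rule AE_mp, intro AE_I2 impI)
    fix \<omega> assume "\<forall>i<K. n i \<omega> = 0"
    then have "final_estimate K X n H g \<omega> = (\<Sum>i<K. \<Sum>j<K. g $ i * (H $$ (i, j) * X j \<omega>))"
      using assms by (simp add: final_estimate_def scalar_prod_def atLeast0LessThan sum_distrib_left)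
    also have "\<dots> = (\<Sum>j<K. (\<Sum>i<K. H $$ (i, j) * g $ i) * X j \<omega>)"
      by (subst sum.swap) (simp add: sum_distrib_left sum_distrib_right mult_ac)
    finally show "(final_estimate K X n H g \<omega> - \<phi>)\<^sup>2
      = ((\<Sum>j<K. (\<Sum>i<K. H $$ (i, j) * g $ i) * X j \<omega>) - \<phi>)\<^sup>2" by simp
  qed
  moreover have "n i \<in> borel_measurable M" if "i < K" for i
    using independent that unfolding indep_vars_def2 by force
  ultimately have "mse M K X n \<phi> H g
      = expectation (\<lambda>\<omega>. ((\<Sum>j<K. (\<Sum>i<K. H $$ (i, j) * g $ i) * X j \<omega>) - \<phi>)\<^sup>2)"
    unfolding mse_def using assms measurable_estimate
    by (intro integral_cong_AE)
      (auto simp: final_estimate_def scalar_prod_def intro!: borel_measurable_power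
        borel_measurable_diff borel_measurable_sum borel_measurable_times borel_measurable_add)
  then show ?thesis by (simp add: expectation_affine_error)
qed

abbreviation min_risk :: real where "min_risk \<equiv> \<sigma>2 * \<phi>\<^sup>2 / ones_eigenvalue"

lemma mse_ge:
  assumes "H \<in> carrier_mat K K" "g \<in> carrier_vec K"
  shows "mse M K X n \<phi> H g \<ge> min_risk"
  unfolding mse_eq_risk[OF assms] by (rule risk_ge[OF \<sigma>2_pos]) simp

lemma mse_eq_min_iff:
  assumes "H \<in> carrier_mat K K" "g \<in> carrier_vec K"
  shows "mse M K X n \<phi> H g = min_risk \<longleftrightarrow> (\<forall>j<K. (\<Sum>i<K. H $$ (i, j) * g $ i) = optimal_weight)"
  unfolding mse_eq_risk[OF assms] by (rule risk_eq_min_iff[OF \<sigma>2_pos]) simp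

section \<open>The autocorrelation matrix and its inverse\<close>

lemma autocorrelation_carrier: "autocorrelation M K X \<in> carrier_mat K K"
  by (simp add: autocorrelation_def)

lemma autocorrelation_index:
  "i < K \<Longrightarrow> j < K \<Longrightarrow> autocorrelation M K X $$ (i, j) = \<phi>\<^sup>2 + (if i = j then \<sigma>2 else 0)"
  by (simp add: autocorrelation_def expectation_estimate_mult)

text \<open>The right factor comes from the Sherman-Morrison formula, the autocorrelation matrix
  being a rank-one update of a multiple of the identity.\<close>

lemma autocorrelation_right_inverse:
  "autocorrelation M K X * mat K K (\<lambda>(i, j). ((if i = j then 1 else 0) - optimal_weight) / \<sigma>2) = 1\<^sub>m K"
    (is "_ * ?B = _")
proof (rule eq_matI)
  fix i j assume ij: "i < dim_row (1\<^sub>m K :: real mat)" "j < dim_col (1\<^sub>m K :: real mat)"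
  have D0: "ones_eigenvalue \<noteq> 0" using ones_eigenvalue_pos by simp
  have s0: "\<sigma>2 \<noteq> 0" using \<sigma>2_pos by simp
  \<comment> \<open>Stated for arbitrary \<open>x\<close> so that simplification does not expand \<open>optimal_weight\<close>.\<close>
  have term_eq: "(\<phi>\<^sup>2 + (if i = k then \<sigma>2 else 0)) * (((if k = j then 1 else 0) - x) / \<sigma>2)
      = (if k = j then (\<phi>\<^sup>2 + (if i = j then \<sigma>2 else 0)) / \<sigma>2 else 0)
        - (if k = i then x else 0) - \<phi>\<^sup>2 * x / \<sigma>2" for k x
    using s0 by (auto simp: field_simps)
  have collect_terms: "(\<phi>\<^sup>2 + (if i = j then \<sigma>2 else 0)) / \<sigma>2 - x - real K * \<phi>\<^sup>2 * x / \<sigma>2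
      = (\<phi>\<^sup>2 - ones_eigenvalue * x) / \<sigma>2 + (if i = j then 1 else 0)" for x
    using s0 by (simp add: field_simps)
  have "(autocorrelation M K X * ?B) $$ (i, j)
      = (\<Sum>k<K. (\<phi>\<^sup>2 + (if i = k then \<sigma>2 else 0)) * (((if k = j then 1 else 0) - optimal_weight)
          / \<sigma>2))"
    using ij autocorrelation_carrier
    by (simp add: scalar_prod_def atLeast0LessThan autocorrelation_index)
  also have "\<dots> = (\<Sum>k<K. (if k = j then (\<phi>\<^sup>2 + (if i = j then \<sigma>2 else 0)) / \<sigma>2 else 0)
      - (if k = i then optimal_weight else 0) - \<phi>\<^sup>2 * optimal_weight / \<sigma>2)"
    by (intro sum.cong refl term_eq)
  also have "\<dots> = (\<phi>\<^sup>2 + (if i = j then \<sigma>2 else 0)) / \<sigma>2 - optimal_weight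
      - real K * \<phi>\<^sup>2 * optimal_weight / \<sigma>2"
    using ij by (simp add: sum_subtractf)
  also have "\<dots> = (\<phi>\<^sup>2 - ones_eigenvalue * optimal_weight) / \<sigma>2 + (if i = j then 1 else 0)"
    by (rule collect_terms)
  \<comment> \<open>This cancels the part common to all entries and leaves those of the
    identity.\<close>
  also have "ones_eigenvalue * optimal_weight = \<phi>\<^sup>2" using D0 by simp
  finally show "(autocorrelation M K X * ?B) $$ (i, j) = 1\<^sub>m K $$ (i, j)"
    using ij by simp
qed (use autocorrelation_carrier in auto)

text \<open>A right inverse of a square matrix is two-sided, so the matrix is a unit and
  \<open>mat_inverse\<close> does not return \<open>None\<close>. This gives \<open>the\<close> in
  \<open>H_star\<close> its intended value.\<close>

lemma autocorrelation_inverse: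
  obtains B where "mat_inverse (autocorrelation M K X) = Some B" "B \<in> carrier_mat K K"
    "autocorrelation M K X * B = 1\<^sub>m K" "B * autocorrelation M K X = 1\<^sub>m K"
proof -
  define C where "C = mat K K (\<lambda>(i, j). ((if i = j then 1 else 0) - optimal_weight) / \<sigma>2)"
  have C: "C \<in> carrier_mat K K" "autocorrelation M K X * C = 1\<^sub>m K"
    using autocorrelation_right_inverse by (auto simp: C_def)
  then have "C * autocorrelation M K X = 1\<^sub>m K"
    using mat_mult_left_right_inverse[OF autocorrelation_carrier] by blast
  then have "autocorrelation M K X \<in> Units (ring_mat TYPE(real) K ())"
    using C autocorrelation_carrier by (auto simp: Units_def ring_mat_def)
  then have "mat_inverse (autocorrelation M K X) \<noteq> None"
    using mat_inverse(1)[OF autocorrelation_carrier, where b = "()"] by blast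
  then show thesis
    using mat_inverse(2)[OF autocorrelation_carrier] that by blast
qed

lemma invertible_autocorrelation: "invertible_mat (autocorrelation M K X)"
proof -
  obtain B where "B \<in> carrier_mat K K"
    "autocorrelation M K X * B = 1\<^sub>m K" "B * autocorrelation M K X = 1\<^sub>m K"
    by (rule autocorrelation_inverse)
  then show ?thesis
    using autocorrelation_carrier
    by (auto simp: invertible_mat_def inverts_mat_def)
qed

section \<open>Minimizers over the channel matrix\<close>

text \<open>The all-ones row is a left eigenvector of the autocorrelation matrix, so multiplying it
  by the inverse divides it by \<open>ones_eigenvalue\<close>.\<close>

lemma
  assumes g: "g \<in> carrier_vec K"
  shows H_star_carrier: "H_star M K X \<phi> g \<in> carrier_mat K K"
    and H_star_index: "\<And>i j. i < K \<Longrightarrow> j < K \<Longrightarrow>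
      H_star M K X \<phi> g $$ (i, j) = optimal_weight / scalar_prod g g * g $ i"
proof -
  obtain B where B: "mat_inverse (autocorrelation M K X) = Some B" "B \<in> carrier_mat K K"
    "autocorrelation M K X * B = 1\<^sub>m K"
    by (rule autocorrelation_inverse)
  let ?R = "autocorrelation M K X" and ?O = "outer_prod g (ones_vec K)"
  have O: "?O \<in> carrier_mat K K"
    using g by (simp add: outer_prod_def ones_vec_def)
  have "?O * ?R = ones_eigenvalue \<cdot>\<^sub>m ?O"
  proof (rule eq_matI)
    fix i j assume "i < dim_row (ones_eigenvalue \<cdot>\<^sub>m ?O)" "j < dim_col (ones_eigenvalue \<cdot>\<^sub>m ?O)"
    then have ij: "i < K" "j < K" using O by auto
    have "(?O * ?R) $$ (i, j) = (\<Sum>k<K. g $ i * (\<phi>\<^sup>2 + (if k = j then \<sigma>2 else 0)))"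
      using ij g autocorrelation_carrier
      by (simp add: scalar_prod_def atLeast0LessThan autocorrelation_index outer_prod_def ones_vec_def)
    also have "\<dots> = ones_eigenvalue * g $ i"
      using ij by (simp add: sum.distrib flip: sum_distrib_left)
    finally show "(?O * ?R) $$ (i, j) = (ones_eigenvalue \<cdot>\<^sub>m ?O) $$ (i, j)"
      using ij g by (simp add: outer_prod_def ones_vec_def)
  qed (use O autocorrelation_carrier in auto)
  moreover have "?O * ?R * B = ?O"
    using O B autocorrelation_carrier by (simp add: assoc_mult_mat[of _ K K _ K _ K])
  ultimately have "ones_eigenvalue \<cdot>\<^sub>m (?O * B) = ?O"
    using mult_smult_assoc_mat[OF O B(2)] by simp
  moreover have "(ones_eigenvalue \<cdot>\<^sub>m (?O * B)) $$ (i, j) = ones_eigenvalue * (?O * B) $$ (i, j)"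
    if "i < K" "j < K" for i j
    using that O B(2) by simp
  ultimately have OB: "ones_eigenvalue * (?O * B) $$ (i, j) = ?O $$ (i, j)" if "i < K" "j < K" for i j
    using that by simp
  show "H_star M K X \<phi> g \<in> carrier_mat K K"
    using O B by (simp add: H_star_def)
  show "H_star M K X \<phi> g $$ (i, j) = optimal_weight / scalar_prod g g * g $ i" if "i < K" "j < K" for i j
  proof -
    have "(?O * B) $$ (i, j) = g $ i / ones_eigenvalue"
      using OB[OF that] ones_eigenvalue_pos that g
      by (simp add: outer_prod_def ones_vec_def eq_divide_eq mult.commute)
    moreover have "H_star M K X \<phi> g $$ (i, j) = \<phi>\<^sup>2 / scalar_prod g g * (?O * B) $$ (i, j)"
      using that O B by (simp add: H_star_def)
    ultimately show ?thesis by simp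
  qed
qed

lemma H_star_effective_weights:
  assumes "g \<in> carrier_vec K" "g \<noteq> 0\<^sub>v K" "j < K"
  shows "(\<Sum>i<K. H_star M K X \<phi> g $$ (i, j) * g $ i) = optimal_weight"
proof -
  have "(\<Sum>i<K. H_star M K X \<phi> g $$ (i, j) * g $ i)
      = optimal_weight / scalar_prod g g * (\<Sum>i<K. g $ i * g $ i)"
    unfolding sum_distrib_left using assms by (intro sum.cong) (simp_all add: H_star_index)
  also have "\<dots> = optimal_weight"
    using scalar_prod_self_pos[OF assms(1,2)] by simp
  finally show ?thesis .
qed

lemma mse_H_star:
  assumes "g \<in> carrier_vec K" "g \<noteq> 0\<^sub>v K"
  shows "mse M K X n \<phi> (H_star M K X \<phi> g) g = min_risk"
  using mse_eq_min_iff[OF H_star_carrier] H_star_effective_weights assms by simp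

text \<open>\<open>H_star\<close> attains the lower bound, so the minimizers are the matrices with
  equality in it. For \<open>K \<ge> 2\<close> there are many; the projection and the norm below
  single out \<open>H_star\<close>.\<close>

lemma is_minimizer_H_iff:
  assumes "g \<in> carrier_vec K" "g \<noteq> 0\<^sub>v K"
  shows "is_minimizer_H M K X n \<phi> g H \<longleftrightarrow>
    H \<in> carrier_mat K K \<and> (\<forall>j<K. (\<Sum>i<K. H $$ (i, j) * g $ i) = optimal_weight)"
proof -
  have "is_minimizer_H M K X n \<phi> g H \<longleftrightarrow> H \<in> carrier_mat K K \<and> mse M K X n \<phi> H g = min_risk"
    using mse_ge[OF _ assms(1)] mse_H_star[OF assms] H_star_carrier[OF assms(1)]
    unfolding is_minimizer_H_def is_arg_min_def by (metis leD le_less not_le)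
  then show ?thesis using mse_eq_min_iff[OF _ assms(1)] by blast
qed

lemma is_minimizer_H_star:
  assumes "g \<in> carrier_vec K" "g \<noteq> 0\<^sub>v K"
  shows "is_minimizer_H M K X n \<phi> g (H_star M K X \<phi> g)"
  using is_minimizer_H_iff H_star_carrier H_star_effective_weights assms by blast

text \<open>For \<open>\<phi> = 0\<close> the optimal weight, and with it \<open>H_star\<close>,
  would vanish.\<close>

lemma rank_H_star:
  assumes g: "g \<in> carrier_vec K" "g \<noteq> 0\<^sub>v K" and "\<phi> \<noteq> 0"
  shows "vec_space.rank K (H_star M K X \<phi> g) = 1"
proof -
  obtain i where i: "i < K" "g $ i \<noteq> 0"
    using g by (metis carrier_vecD eq_vecI index_zero_vec)
  have "optimal_weight / scalar_prod g g \<noteq> 0"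
    using ones_eigenvalue_pos scalar_prod_self_pos[OF g] \<open>\<phi> \<noteq> 0\<close> by simp
  \<comment> \<open>All columns of \<open>H_star\<close> coincide, so column 0, present since
    \<open>K \<ge> 1\<close>, serves as the nonzero one.\<close>
  then show ?thesis
    using vec_space.rank_one_product_entries[of "H_star M K X \<phi> g" K K "\<lambda>i. g $ i"
        "\<lambda>_. optimal_weight / scalar_prod g g" i 0] H_star_carrier[OF g(1)] H_star_index[OF g(1)] i K_pos
    by (simp add: mult.commute)
qed

text \<open>The left matrix projects each column of \<open>H\<close> onto the line of
  \<open>g\<close>, with a coefficient proportional to its effective weight. Minimality thus fixes
  this part of \<open>H\<close> and leaves the part orthogonal to \<open>g\<close> free.\<close>

lemma projection_eq_H_star_iff:
  assumes g: "g \<in> carrier_vec K" "g \<noteq> 0\<^sub>v K" and H: "H \<in> carrier_mat K K"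
  shows "(1 / scalar_prod g g) \<cdot>\<^sub>m (outer_prod g g * H) = H_star M K X \<phi> g \<longleftrightarrow>
    (\<forall>j<K. (\<Sum>i<K. H $$ (i, j) * g $ i) = optimal_weight)"
    (is "?P = ?S \<longleftrightarrow> (\<forall>j<K. ?a j = optimal_weight)")
proof -
  have P: "?P \<in> carrier_mat K K"
    using g H by (auto simp: outer_prod_def)
  have entry: "?P $$ (i, j) = ?a j / scalar_prod g g * g $ i" if "i < K" "j < K" for i j
  proof -
    have "(outer_prod g g * H) $$ (i, j) = (\<Sum>k<K. g $ i * (H $$ (k, j) * g $ k))"
      using g H that by (simp add: outer_prod_def scalar_prod_def atLeast0LessThan mult_ac)
    then show ?thesis
      using g H that by (simp add: outer_prod_def flip: sum_distrib_left)
  qed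
  obtain i where i: "i < K" "g $ i \<noteq> 0"
    using g by (metis carrier_vecD eq_vecI index_zero_vec)
  show ?thesis
  proof
    assume "?P = ?S"
    then have "?a j / scalar_prod g g * g $ i = optimal_weight / scalar_prod g g * g $ i" if "j < K" for j
      using entry[OF i(1) that] H_star_index[OF g(1) i(1) that] by simp
    moreover have "scalar_prod g g \<noteq> 0"
      using scalar_prod_self_pos(2)[OF g] by simp
    ultimately show "\<forall>j<K. ?a j = optimal_weight"
      using i(2) unfolding mult_cancel_right divide_cancel_right by blast
  next
    assume "\<forall>j<K. ?a j = optimal_weight"
    then show "?P = ?S"
      using P H_star_carrier[OF g(1)] entry H_star_index[OF g(1)]
      by (intro eq_matI) (auto simp del: index_smult_mat(1))
  qed
qed

text \<open>The columns of \<open>H_star\<close> are multiples of \<open>g\<close>, while those of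
  the difference \<open>E\<close> of two minimizers are orthogonal to \<open>g\<close>; Pythagoras
  applies.\<close>

lemma frobenius_norm_H_star_less:
  assumes g: "g \<in> carrier_vec K" "g \<noteq> 0\<^sub>v K"
    and min: "is_minimizer_H M K X n \<phi> g H" and ne: "H \<noteq> H_star M K X \<phi> g"
  shows "frobenius_norm (H_star M K X \<phi> g) < frobenius_norm H"
proof -
  let ?S = "H_star M K X \<phi> g"
  define E where "E i j = H $$ (i, j) - ?S $$ (i, j)" for i j
  have H: "H \<in> carrier_mat K K" and a: "\<forall>j<K. (\<Sum>i<K. H $$ (i, j) * g $ i) = optimal_weight"
    using min is_minimizer_H_iff[OF g] by auto
  have S: "?S \<in> carrier_mat K K" by (rule H_star_carrier[OF g(1)])
  have "(\<Sum>i<K. E i j * g $ i) = 0" if "j < K" for j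
    using a H_star_effective_weights[OF g that] that
    by (simp add: E_def left_diff_distrib sum_subtractf)
  moreover have "(\<Sum>i<K. \<Sum>j<K. E i j * ?S $$ (i, j))
      = (\<Sum>j<K. optimal_weight / scalar_prod g g * (\<Sum>i<K. E i j * g $ i))"
    unfolding sum_distrib_left
    by (subst sum.swap) (intro sum.cong, simp_all add: H_star_index[OF g(1)])
  ultimately have orth: "(\<Sum>i<K. \<Sum>j<K. E i j * ?S $$ (i, j)) = 0" by simp
  have "(\<Sum>i<K. \<Sum>j<K. (H $$ (i, j))\<^sup>2)
      = (\<Sum>i<K. \<Sum>j<K. (?S $$ (i, j))\<^sup>2 + (E i j)\<^sup>2 + 2 * (E i j * ?S $$ (i, j)))"
    by (intro sum.cong) (simp_all add: E_def power2_eq_square algebra_simps)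
  also have "\<dots> = (\<Sum>i<K. \<Sum>j<K. (?S $$ (i, j))\<^sup>2) + (\<Sum>i<K. \<Sum>j<K. (E i j)\<^sup>2)"
    using orth by (simp add: sum.distrib flip: sum_distrib_left)
  finally have pythagoras: "(\<Sum>i<K. \<Sum>j<K. (H $$ (i, j))\<^sup>2)
      = (\<Sum>i<K. \<Sum>j<K. (?S $$ (i, j))\<^sup>2) + (\<Sum>i<K. \<Sum>j<K. (E i j)\<^sup>2)" .
  obtain i j where ij: "i < K" "j < K" "E i j \<noteq> 0"
    using ne H S by (auto simp: E_def mat_eq_iff)
  then have "(\<Sum>j<K. (E i j)\<^sup>2) > 0"
    by (intro sum_pos2[of _ j]) auto
  then have "(\<Sum>i<K. \<Sum>j<K. (E i j)\<^sup>2) > 0"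
    using ij by (intro sum_pos2[of "{..<K}" i "\<lambda>i. \<Sum>j<K. (E i j)\<^sup>2"]) (simp_all add: sum_nonneg)
  then show ?thesis
    using H S pythagoras by (simp add: frobenius_norm_def)
qed

section \<open>Minimization over the combining vector and the minimal errors\<close>

lemma is_minimizer_g_exists:
  assumes "H \<in> carrier_mat K K"
  shows "\<exists>g. is_minimizer_g M K X n \<phi> H g"
proof -
  obtain x where x: "\<forall>y. risk K \<sigma>2 (\<phi>\<^sup>2) (\<lambda>j. \<Sum>i<K. H $$ (i, j) * x i)
      \<le> risk K \<sigma>2 (\<phi>\<^sup>2) (\<lambda>j. \<Sum>i<K. H $$ (i, j) * y i)"
    using risk_linear_minimizer_exists[where K = K and m = K and B = "\<lambda>j i. H $$ (i, j)"
        and s = \<sigma>2 and p = "\<phi>\<^sup>2"] \<sigma>2_pos by auto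
  have "mse M K X n \<phi> H (vec K x) \<le> mse M K X n \<phi> H g" if "g \<in> carrier_vec K" for g
    using x[rule_format, of "\<lambda>i. g $ i"] that assms by (simp add: mse_eq_risk)
  then have "is_minimizer_g M K X n \<phi> H (vec K x)"
    by (auto simp: is_minimizer_g_def is_arg_min_def not_less)
  then show ?thesis ..
qed

lemma min_mse_over_H_eq:
  assumes "g \<in> carrier_vec K" "g \<noteq> 0\<^sub>v K"
  shows "min_mse_over_H M K X n \<phi> g = min_risk"
  unfolding min_mse_over_H_def
  using mse_H_star[OF assms] H_star_carrier[OF assms(1)] mse_ge[OF _ assms(1)]
  by (intro cInf_eq_minimum) (auto intro!: image_eqI[of _ _ "H_star M K X \<phi> g"])

lemma min_mse_over_g_ge:
  assumes "H \<in> carrier_mat K K"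
  shows "min_mse_over_g M K X n \<phi> H \<ge> min_risk"
  unfolding min_mse_over_g_def
  \<comment> \<open>The zero vector shows that the infimum ranges over a nonempty set.\<close>
  using mse_ge[OF assms] by (intro cINF_greatest) (auto intro: zero_carrier_vec)

lemma min_mse_over_g_one_mat: "min_mse_over_g M K X n \<phi> (1\<^sub>m K) = min_risk"
proof -
  have "(\<Sum>i<K. 1\<^sub>m K $$ (i, j) * vec K (\<lambda>_. optimal_weight) $ i)
      = (\<Sum>i<K. if i = j then optimal_weight else 0)"
    if "j < K" for j
    using that by (intro sum.cong) auto
  then have "mse M K X n \<phi> (1\<^sub>m K) (vec K (\<lambda>_. optimal_weight)) = min_risk"
    by (subst mse_eq_min_iff) auto
  then show ?thesis
    unfolding min_mse_over_g_def using mse_ge[of "1\<^sub>m K"]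
    by (intro cInf_eq_minimum) (auto intro!: image_eqI[of _ _ "vec K (\<lambda>_. optimal_weight)"])
qed

text \<open>Enlarging the summand \<open>\<sigma>2\<close> of the denominator to
  \<open>real K * \<sigma>2\<close>, possible as \<open>K \<ge> 1\<close>, splits off
  \<open>1 / real K\<close> with a factor independent of \<open>K\<close>.\<close>

lemma min_risk_ge: "min_risk \<ge> \<phi>\<^sup>2 / (\<sigma>2 + \<phi>\<^sup>2) * (\<sigma>2 / real K)"
proof -
  have "ones_eigenvalue \<le> (\<sigma>2 + \<phi>\<^sup>2) * real K"
    using K_pos \<sigma>2_pos mult_left_mono[of 1 "real K" \<sigma>2] by (simp add: algebra_simps)
  then have "\<sigma>2 * \<phi>\<^sup>2 / ((\<sigma>2 + \<phi>\<^sup>2) * real K) \<le> min_risk"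
    using ones_eigenvalue_pos \<sigma>2_pos
    by (intro divide_left_mono) (auto intro: mult_pos_pos add_pos_nonneg)
  then show ?thesis by (simp add: mult.commute)
qed

end

section \<open>The result for a sequence of models indexed by the number of clusters\<close>

theorem mainTheorem5:
  fixes \<phi> v :: real
    and N\<^sub>e r :: nat
    and M :: "nat \<Rightarrow> 'a measure"
    and X n :: "nat \<Rightarrow> nat \<Rightarrow> 'a \<Rightarrow> real"
    and g :: "nat \<Rightarrow> real vec"
  assumes "N\<^sub>e \<ge> 1" and "r \<ge> 1"
    and noiseless: "v = 0"
    and model: "\<And>K. K \<ge> 1 \<Longrightarrow> cluster_model (M K) K N\<^sub>e r \<phi> v (X K) (n K)"
    and combining: "\<And>K. K \<ge> 1 \<Longrightarrow> g K \<in> carrier_vec K \<and> g K \<noteq> 0\<^sub>v K"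
  shows
    \<comment> \<open>minimization over \<open>H\<close> for given \<open>g\<close>\<close>
    "(\<forall>K\<ge>1. invertible_mat (autocorrelation (M K) K (X K))
        \<and> is_minimizer_H (M K) K (X K) (n K) \<phi> (g K) (H_star (M K) K (X K) \<phi> (g K))
        \<and> (\<phi> \<noteq> 0 \<longrightarrow> vec_space.rank K (H_star (M K) K (X K) \<phi> (g K)) = 1)
        \<and> (\<forall>H \<in> carrier_mat K K. is_minimizer_H (M K) K (X K) (n K) \<phi> (g K) H \<longleftrightarrow>
              (1 / scalar_prod (g K) (g K)) \<cdot>\<^sub>m (outer_prod (g K) (g K) * H)
                = H_star (M K) K (X K) \<phi> (g K))
        \<and> (\<forall>H. is_minimizer_H (M K) K (X K) (n K) \<phi> (g K) H
              \<and> H \<noteq> H_star (M K) K (X K) \<phi> (g K) \<longrightarrow>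
              frobenius_norm (H_star (M K) K (X K) \<phi> (g K)) < frobenius_norm H))
     \<comment> \<open>minimization over \<open>g\<close> for given \<open>H\<close>; the full-rank choice \<open>H = I\<close> is optimal\<close>
     \<and> (\<forall>K\<ge>1. (\<forall>H \<in> carrier_mat K K. \<exists>g'. is_minimizer_g (M K) K (X K) (n K) \<phi> H g')
        \<and> vec_space.rank K (1\<^sub>m K :: real mat) = K
        \<and> (\<forall>H \<in> carrier_mat K K.
              min_mse_over_g (M K) K (X K) (n K) \<phi> (1\<^sub>m K)
                \<le> min_mse_over_g (M K) K (X K) (n K) \<phi> H))
     \<comment> \<open>scaling of the minimal error in both scenarios\<close>
     \<and> (\<phi> \<noteq> 0 \<longrightarrow>
          (\<lambda>K. min_mse_over_H (M K) K (X K) (n K) \<phi> (g K))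
            \<in> \<Omega>(\<lambda>K. 1 / (real K * (real N\<^sub>e)\<^sup>2 * real r))
        \<and> (\<forall>H. (\<forall>K\<ge>1. H K \<in> carrier_mat K K) \<longrightarrow>
            (\<lambda>K. min_mse_over_g (M K) K (X K) (n K) \<phi> (H K))
              \<in> \<Omega>(\<lambda>K. 1 / (real K * (real N\<^sub>e)\<^sup>2 * real r))))
     \<comment> \<open>equal optimal errors with channel matrices of different rank\<close>
     \<and> (\<forall>K\<ge>1. min_mse_over_H (M K) K (X K) (n K) \<phi> (g K)
              = min_mse_over_g (M K) K (X K) (n K) \<phi> (1\<^sub>m K))
     \<and> (\<phi> \<noteq> 0 \<longrightarrow> (\<forall>K\<ge>2. vec_space.rank K (H_star (M K) K (X K) \<phi> (g K))
              \<noteq> vec_space.rank K (1\<^sub>m K :: real mat)))"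
proof -
  have M: "noiseless_cluster_model (M K) K N\<^sub>e r \<phi> v (X K) (n K)" if "K \<ge> 1" for K
    using model[OF that] noiseless
    by (intro noiseless_cluster_model.intro noiseless_cluster_model_axioms.intro)
  have g: "g K \<in> carrier_vec K" "g K \<noteq> 0\<^sub>v K" if "K \<ge> 1" for K
    using combining[OF that] by auto
  define s where "s = 1 / ((real N\<^sub>e)\<^sup>2 * real r)"
  \<comment> \<open>\<open>\<sigma>2\<close> depends only on \<open>N\<^sub>e\<close> and
    \<open>r\<close>, so the instance \<open>K = 1\<close> determines it for all
    \<open>K\<close>.\<close>
  have s: "noiseless_cluster_model.\<sigma>2 N\<^sub>e r = s"
    using noiseless_cluster_model.\<sigma>2_def[OF M[of 1]] by (simp add: s_def)
  note rank_H_star = noiseless_cluster_model.rank_H_star[OF M g]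
  have ge_g: "min_mse_over_g (M K) K (X K) (n K) \<phi> (1\<^sub>m K)
      \<le> min_mse_over_g (M K) K (X K) (n K) \<phi> H" if "K \<ge> 1" "H \<in> carrier_mat K K" for K H
    using noiseless_cluster_model.min_mse_over_g_ge[OF M[OF that(1)] that(2)]
      noiseless_cluster_model.min_mse_over_g_one_mat[OF M[OF that(1)]] by simp
  have eq: "min_mse_over_H (M K) K (X K) (n K) \<phi> (g K)
      = min_mse_over_g (M K) K (X K) (n K) \<phi> (1\<^sub>m K)" if "K \<ge> 1" for K
    using noiseless_cluster_model.min_mse_over_H_eq[OF M[OF that] g[OF that]]
      noiseless_cluster_model.min_mse_over_g_one_mat[OF M[OF that]] by simp
  \<comment> \<open>Stated for any \<open>f\<close> above the error of the identity channel, so that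
    it serves both scenarios.\<close>
  have scaling: "f \<in> \<Omega>(\<lambda>K. 1 / (real K * (real N\<^sub>e)\<^sup>2 * real r))"
    if "\<phi> \<noteq> 0" and f: "\<And>K. K \<ge> 1 \<Longrightarrow> min_mse_over_g (M K) K (X K) (n K) \<phi> (1\<^sub>m K) \<le> f K"
    for f :: "nat \<Rightarrow> real"
  proof (rule landau_omega.bigI)
    have "s > 0" using assms(1,2) by (simp add: s_def)
    \<comment> \<open>The factor from \<open>min_risk_ge\<close>, positive because
      \<open>\<phi> \<noteq> 0\<close>.\<close>
    then show "\<phi>\<^sup>2 / (s + \<phi>\<^sup>2) > 0" using \<open>\<phi> \<noteq> 0\<close> by (simp add: add_pos_pos)
    have "\<phi>\<^sup>2 / (s + \<phi>\<^sup>2) * norm (1 / (real K * (real N\<^sub>e)\<^sup>2 * real r)) \<le> norm (f K)" if "K \<ge> 1" for K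
    proof -
      have le: "\<phi>\<^sup>2 / (s + \<phi>\<^sup>2) * (s / real K) \<le> f K"
        using noiseless_cluster_model.min_risk_ge[OF M[OF that]] f[OF that]
          noiseless_cluster_model.min_mse_over_g_one_mat[OF M[OF that]]
        unfolding s by linarith
      have norm: "norm (1 / (real K * (real N\<^sub>e)\<^sup>2 * real r)) = s / real K"
        by (simp add: s_def mult.commute mult.left_commute)
      show ?thesis unfolding norm by (rule order_trans[OF le]) simp
    qed
    then show "\<forall>\<^sub>F K in sequentially.
        \<phi>\<^sup>2 / (s + \<phi>\<^sup>2) * norm (1 / (real K * (real N\<^sub>e)\<^sup>2 * real r)) \<le> norm (f K)"
      by (intro eventually_sequentiallyI)
  qed
  have minimizer_iff: "is_minimizer_H (M K) K (X K) (n K) \<phi> (g K) H \<longleftrightarrow>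
      (1 / scalar_prod (g K) (g K)) \<cdot>\<^sub>m (outer_prod (g K) (g K) * H) = H_star (M K) K (X K) \<phi> (g K)"
    if "K \<ge> 1" "H \<in> carrier_mat K K" for K H
    using noiseless_cluster_model.is_minimizer_H_iff[OF M[OF that(1)] g[OF that(1)]]
      noiseless_cluster_model.projection_eq_H_star_iff[OF M[OF that(1)] g[OF that(1)] that(2)] that(2)
    by simp
  show ?thesis
  proof (intro conjI allI impI ballI)
    fix K :: nat assume K: "1 \<le> K"
    show "invertible_mat (autocorrelation (M K) K (X K))"
      by (rule noiseless_cluster_model.invertible_autocorrelation[OF M[OF K]])
    show "is_minimizer_H (M K) K (X K) (n K) \<phi> (g K) (H_star (M K) K (X K) \<phi> (g K))"
      by (rule noiseless_cluster_model.is_minimizer_H_star[OF M[OF K] g[OF K]])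
  next
    fix K :: nat assume "1 \<le> K" "\<phi> \<noteq> 0"
    then show "vec_space.rank K (H_star (M K) K (X K) \<phi> (g K)) = 1"
      by (intro rank_H_star)
  next
    fix K :: nat and H assume K: "1 \<le> K"
      and "is_minimizer_H (M K) K (X K) (n K) \<phi> (g K) H \<and> H \<noteq> H_star (M K) K (X K) \<phi> (g K)"
    then show "frobenius_norm (H_star (M K) K (X K) \<phi> (g K)) < frobenius_norm H"
      using noiseless_cluster_model.frobenius_norm_H_star_less[OF M[OF K] g[OF K]] by blast
  next
    fix K :: nat and H :: "real mat" assume "1 \<le> K" "H \<in> carrier_mat K K"
    then show "\<exists>g'. is_minimizer_g (M K) K (X K) (n K) \<phi> H g'"
      by (rule noiseless_cluster_model.is_minimizer_g_exists[OF M])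
  next
    fix K :: nat assume "\<phi> \<noteq> 0" "2 \<le> K"
    \<comment> \<open>The ranks are 1 and \<open>K\<close>.\<close>
    then show "vec_space.rank K (H_star (M K) K (X K) \<phi> (g K)) \<noteq> vec_space.rank K (1\<^sub>m K :: real mat)"
      by (simp add: rank_H_star rank_identity_mat)
  \<comment> \<open>In the two scaling goals the hypothesis of \<open>scaling\<close> comes from
    \<open>eq\<close> and from \<open>ge_g\<close> respectively.\<close>
  qed (use minimizer_iff ge_g eq rank_identity_mat in \<open>auto intro!: scaling\<close>)
qed

end
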